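(* For every $n\ge1$ and $\mu\in\mathrm{WComp}_{n-1}$ there is a bijection between $\mathsf{Lyn}_\mu$ and $\mathsf{Comb}_\mu$.
   Context: $\mathrm{WComp}_{n-1}$: weak compositions with sum $n-1$. Labeled colored binary trees on $[n]$: planar rooted binary trees (internal node $x$ has left child $L(x)$, right child $R(x)$) with leaves labeled bijectively by $[n]$ and internal nodes colored in $\mathbb{P}$. Valency $v(x)$: smallest leaf label below $x$. Normalized: $v(x)=v(L(x))$ for every internal $x$. An internal node $x$ is a Lyndon node if $L(x)$ is a leaf or $v(R(L(x)))>v(R(x))$. A colored Lyndon tree is normalized with $\mathrm{color}(L(x))>\mathrm{color}(x)$ for every non-Lyndon internal node $x$. A colored comb is a normalized labeled colored binary tree such that for each internal node $x$ whose right child $R(x)$ is not a leaf, $\mathrm{color}(x)>\mathrm{color}(R(x))$. $\mathsf{Lyn}_\mu$ (resp. $\mathsf{Comb}_\mu$) is the set of colored Lyndon trees (resp. colored combs) on $[n]$ with exactly $\mu(j)$ internal nodes of color $j$ for each $j$. *)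

theory Defs
  imports Main
begin

text \<open>
  Planar rooted (full) binary trees; leaves carry a label, internal nodes a color.
  Labels and colors are natural numbers; that the colors are positive is part of
  \<open>labeled_trees\<close> below.
\<close>

datatype ctree =
    is_leaf: Leaf (label: nat)
  | Node (color: nat) (left: ctree) (right: ctree)

primrec leaves :: "ctree \<Rightarrow> nat list" where
  "leaves (Leaf a) = [a]"
| "leaves (Node c l r) = leaves l @ leaves r"

text \<open>
  A node is identified with the subtree it roots; no two nodes are conflated when the
  leaf labels are distinct. Node colors are collected in a list, hence with multiplicity.
\<close>

primrec nodes :: "ctree \<Rightarrow> ctree set" where
  "nodes (Leaf a) = {Leaf a}"
| "nodes (Node c l r) = insert (Node c l r) (nodes l \<union> nodes r)"

definition internal_nodes :: "ctree \<Rightarrow> ctree set" where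
  "internal_nodes t = {x \<in> nodes t. \<not> is_leaf x}"

primrec node_colors :: "ctree \<Rightarrow> nat list" where
  "node_colors (Leaf a) = []"
| "node_colors (Node c l r) = c # node_colors l @ node_colors r"

definition labeled_trees :: "nat \<Rightarrow> ctree set" where
  "labeled_trees n = {t. distinct (leaves t) \<and> set (leaves t) = {1..n} \<and>
     (\<forall>c \<in> set (node_colors t). c \<ge> 1)}"

definition valency :: "ctree \<Rightarrow> nat" where
  "valency x = Min (set (leaves x))"

definition normalized :: "ctree \<Rightarrow> bool" where
  "normalized t \<longleftrightarrow> (\<forall>x \<in> internal_nodes t. valency x = valency (left x))"

text \<open>Only meaningful for internal nodes \<open>x\<close>.\<close>

definition lyndon_node :: "ctree \<Rightarrow> bool" where
  "lyndon_node x \<longleftrightarrow> is_leaf (left x) \<or> valency (right (left x)) > valency (right x)"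

definition colored_lyndon :: "ctree \<Rightarrow> bool" where
  "colored_lyndon t \<longleftrightarrow> normalized t \<and>
     (\<forall>x \<in> internal_nodes t. \<not> lyndon_node x \<longrightarrow> color (left x) > color x)"

definition colored_comb :: "ctree \<Rightarrow> bool" where
  "colored_comb t \<longleftrightarrow> normalized t \<and>
     (\<forall>x \<in> internal_nodes t. \<not> is_leaf (right x) \<longrightarrow> color x > color (right x))"

text \<open>
  Weak compositions are finitely supported sequences indexed by the positive integers;
  here they are functions on \<open>nat\<close> vanishing at 0. Finiteness is explicit because
  sums over infinite sets are 0.
\<close>

definition WComp :: "nat \<Rightarrow> (nat \<Rightarrow> nat) set" where
  "WComp m = {\<mu>. \<mu> 0 = 0 \<and> finite {j. \<mu> j \<noteq> 0} \<and> (\<Sum>j | \<mu> j \<noteq> 0. \<mu> j) = m}"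

definition Lyn :: "nat \<Rightarrow> (nat \<Rightarrow> nat) \<Rightarrow> ctree set" where
  "Lyn n \<mu> = {t \<in> labeled_trees n. colored_lyndon t \<and>
     (\<forall>j \<ge> 1. count_list (node_colors t) j = \<mu> j)}"

definition Comb :: "nat \<Rightarrow> (nat \<Rightarrow> nat) \<Rightarrow> ctree set" where
  "Comb n \<mu> = {t \<in> labeled_trees n. colored_comb t \<and>
     (\<forall>j \<ge> 1. count_list (node_colors t) j = \<mu> j)}"

end

theory Submission
  imports Defs
begin

text \<open>
  Read the left spine of a normalized tree from the bottom up: a normalized tree is its smallest
  leaf followed by a sequence of colored normalized trees, so it amounts to an increasing ordered
  tree with colored non-root vertices. Cut the sequence at the tree whose valency \<open>b\<close> is least:
  with \<open>A\<close> the part before it, \<open>B\<close> the sequence hanging below \<open>b\<close> and \<open>C\<close> the part after it,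
  recursion gives an increasing ternary tree with root \<open>b\<close> and subtrees \<open>A\<close>, \<open>B\<close>, \<open>C\<close>.

  The Lyndon condition says that the color of every vertex \<open>b\<close> exceeds that of the first vertex of
  its \<open>C\<close>, where the first vertex is reached through the subtrees \<open>A\<close>; the comb condition says that
  it exceeds the color of the last vertex of its \<open>B\<close>, where the last vertex is reached through the
  subtrees \<open>C\<close>. Hence the cyclic rotation \<open>(A, B, C) \<mapsto> (B, C, A)\<close> at every vertex turns one
  condition into the other, and it moves neither labels nor colors between vertices.
\<close>

section \<open>Increasing ternary trees and their rotation\<close>

datatype ttree = Tip | Vert nat nat ttree ttree ttree

primrec labels :: "ttree \<Rightarrow> nat list" where
  "labels Tip = []"
| "labels (Vert b c A B C) = labels A @ b # labels B @ labels C"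

primrec colors :: "ttree \<Rightarrow> nat list" where
  "colors Tip = []"
| "colors (Vert b c A B C) = c # colors A @ colors B @ colors C"

primrec increasing :: "ttree \<Rightarrow> bool" where
  "increasing Tip \<longleftrightarrow> True"
| "increasing (Vert b c A B C) \<longleftrightarrow> increasing A \<and> increasing B \<and> increasing C \<and>
     (\<forall>x \<in> set (labels A) \<union> set (labels B) \<union> set (labels C). b < x)"

text \<open>The label is kept next to the color because the Lyndon condition also compares
  valencies.\<close>

primrec first :: "ttree \<Rightarrow> (nat \<times> nat) option" where
  "first Tip = None"
| "first (Vert b c A B C) = (if A = Tip then Some (b, c) else first A)"

primrec last_color :: "ttree \<Rightarrow> nat option" where
  "last_color Tip = None"
| "last_color (Vert b c A B C) = (if C = Tip then Some c else last_color C)"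

primrec lyndon :: "ttree \<Rightarrow> bool" where
  "lyndon Tip \<longleftrightarrow> True"
| "lyndon (Vert b c A B C) \<longleftrightarrow> lyndon A \<and> lyndon B \<and> lyndon C \<and>
     (\<forall>d c'. first C = Some (d, c') \<longrightarrow> c' < c)"

primrec comb :: "ttree \<Rightarrow> bool" where
  "comb Tip \<longleftrightarrow> True"
| "comb (Vert b c A B C) \<longleftrightarrow> comb A \<and> comb B \<and> comb C \<and>
     (\<forall>c'. last_color B = Some c' \<longrightarrow> c' < c)"

primrec rot3 :: "ttree \<Rightarrow> ttree" where
  "rot3 Tip = Tip"
| "rot3 (Vert b c A B C) = Vert b c (rot3 B) (rot3 C) (rot3 A)"

lemma rot3_rot3_rot3 [simp]: "rot3 (rot3 (rot3 t)) = t"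
  by (induction t) auto

lemma rot3_eq_Tip_iff [simp]: "rot3 t = Tip \<longleftrightarrow> t = Tip"
  by (cases t) auto

lemma set_labels_rot3 [simp]: "set (labels (rot3 t)) = set (labels t)"
  by (induction t) auto

lemma length_labels_rot3 [simp]: "length (labels (rot3 t)) = length (labels t)"
  by (induction t) auto

lemma distinct_labels_rot3 [simp]: "distinct (labels (rot3 t)) \<longleftrightarrow> distinct (labels t)"
  by (metis card_distinct distinct_card length_labels_rot3 set_labels_rot3)

lemma set_colors_rot3 [simp]: "set (colors (rot3 t)) = set (colors t)"
  by (induction t) auto

lemma count_colors_rot3 [simp]: "count_list (colors (rot3 t)) j = count_list (colors t) j"
  by (induction t) auto

lemma increasing_rot3 [simp]: "increasing (rot3 t) \<longleftrightarrow> increasing t"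
  by (induction t) auto

text \<open>Rotation moves \<open>A\<close> into the place of \<open>C\<close>, so the path through
  the third subtrees of \<open>rot3 t\<close> is the path through the first subtrees of
  \<open>t\<close>.\<close>

lemma last_color_rot3 [simp]: "last_color (rot3 t) = map_option snd (first t)"
  by (induction t) auto

lemma comb_rot3 [simp]: "comb (rot3 t) \<longleftrightarrow> lyndon t"
  by (induction t) auto

section \<open>From ternary trees to normalized binary trees\<close>

text \<open>\<open>graft s t\<close> stacks the sequence encoded by \<open>t\<close> on top of the left spine of \<open>s\<close>.\<close>

primrec graft :: "ctree \<Rightarrow> ttree \<Rightarrow> ctree" where
  "graft s Tip = s"
| "graft s (Vert b c A B C) = graft (Node c (graft s A) (graft (Leaf b) B)) C"

lemma leaves_nonempty [simp]: "leaves t \<noteq> []"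
  by (induction t) auto

lemma valency_Leaf [simp]: "valency (Leaf a) = a"
  by (simp add: valency_def)

lemma valency_Node [simp]: "valency (Node c l r) = min (valency l) (valency r)"
  by (simp add: valency_def Min_Un)

lemma valency_in_leaves: "valency t \<in> set (leaves t)"
  unfolding valency_def by (rule Min_in) auto

lemma valency_le: "x \<in> set (leaves t) \<Longrightarrow> valency t \<le> x"
  unfolding valency_def by simp

lemma internal_nodes_Leaf [simp]: "internal_nodes (Leaf a) = {}"
  by (auto simp: internal_nodes_def)

lemma internal_nodes_Node [simp]:
  "internal_nodes (Node c l r) = insert (Node c l r) (internal_nodes l \<union> internal_nodes r)"
  by (auto simp: internal_nodes_def)

lemma normalized_Leaf [simp]: "normalized (Leaf a)"
  by (simp add: normalized_def)

lemma normalized_Node [simp]: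
  "normalized (Node c l r) \<longleftrightarrow> normalized l \<and> normalized r \<and> valency l \<le> valency r"
  by (auto simp: normalized_def min_def)

text \<open>What the Lyndon condition demands of a node with left child \<open>s\<close>, color \<open>c\<close>, and a right
  child of valency \<open>d\<close>.\<close>

definition stackable :: "ctree \<Rightarrow> nat \<Rightarrow> nat \<Rightarrow> bool" where
  "stackable s d c \<longleftrightarrow> is_leaf s \<or> d < valency (right s) \<or> c < color s"

lemma colored_lyndon_Leaf [simp]: "colored_lyndon (Leaf a)"
  by (simp add: colored_lyndon_def)

lemma colored_lyndon_Node [simp]:
  "colored_lyndon (Node c l r) \<longleftrightarrow>
     colored_lyndon l \<and> colored_lyndon r \<and> valency l \<le> valency r \<and> stackable l (valency r) c"
  by (auto simp: colored_lyndon_def lyndon_node_def stackable_def)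

lemma colored_comb_Leaf [simp]: "colored_comb (Leaf a)"
  by (simp add: colored_comb_def)

lemma colored_comb_Node [simp]:
  "colored_comb (Node c l r) \<longleftrightarrow>
     colored_comb l \<and> colored_comb r \<and> valency l \<le> valency r \<and> (\<not> is_leaf r \<longrightarrow> color r < c)"
  by (auto simp: colored_comb_def)

lemma leaves_graft [simp]: "leaves (graft s t) = leaves s @ labels t"
  by (induction t arbitrary: s) auto

lemma set_node_colors_graft [simp]:
  "set (node_colors (graft s t)) = set (node_colors s) \<union> set (colors t)"
  by (induction t arbitrary: s) auto

lemma count_node_colors_graft [simp]:
  "count_list (node_colors (graft s t)) j = count_list (node_colors s) j + count_list (colors t) j"
  by (induction t arbitrary: s) auto

lemma valency_graft:
  assumes "\<forall>x \<in> set (labels t). valency s < x"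
  shows "valency (graft s t) = valency s"
proof (rule antisym)
  show "valency (graft s t) \<le> valency s"
    by (rule valency_le) (simp add: valency_in_leaves)
  show "valency s \<le> valency (graft s t)"
    using valency_in_leaves[of "graft s t"] assms by (auto simp: valency_le)
qed

lemma is_leaf_graft [simp]: "is_leaf (graft s t) \<longleftrightarrow> is_leaf s \<and> t = Tip"
  by (induction t arbitrary: s) auto

text \<open>The root of the grafted tree is the node that attaches the topmost tree of the sequence,
  hence the last vertex.\<close>

lemma color_graft: "last_color t = Some c \<Longrightarrow> color (graft s t) = c"
  by (induction t arbitrary: s c) (auto split: if_splits)

text \<open>Needed to see that a node grafted above a nonempty \<open>A\<close> with a right child
  of valency below all labels of \<open>A\<close> is Lyndon.\<close>

lemma valency_right_graft:
  assumes "t \<noteq> Tip" "increasing t"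
  shows "valency (right (graft s t)) \<in> set (labels t)"
  using assms
proof (induction t arbitrary: s)
  case (Vert b c A B C)
  then show ?case
    by (cases "C = Tip") (auto simp: valency_graft)
qed simp

lemma last_color_eq_None_iff [simp]: "last_color t = None \<longleftrightarrow> t = Tip"
  by (induction t) auto

lemma first_in_labels: "first t = Some (d, c) \<Longrightarrow> d \<in> set (labels t)"
  by (induction t) (auto split: if_splits)

lemma normalized_graft:
  assumes "increasing t" "\<forall>x \<in> set (labels t). valency s < x" "normalized s"
  shows "normalized (graft s t)"
  using assms
proof (induction t arbitrary: s)
  case (Vert b c A B C)
  then show ?case by (simp add: valency_graft)
qed simp

text \<open>The comb condition looks only at right subtrees, so it never relates \<open>s\<close> to
  \<open>t\<close>.\<close>

lemma colored_comb_graft: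
  assumes "increasing t" "\<forall>x \<in> set (labels t). valency s < x"
  shows "colored_comb (graft s t) \<longleftrightarrow> colored_comb s \<and> comb t"
  using assms
proof (induction t arbitrary: s)
  case (Vert b c A B C)
  have "(\<not> is_leaf (graft (Leaf b) B) \<longrightarrow> color (graft (Leaf b) B) < c) \<longleftrightarrow>
        (\<forall>c'. last_color B = Some c' \<longrightarrow> c' < c)"
    by (cases "last_color B") (auto simp: color_graft)
  with Vert show ?case by (auto simp: valency_graft)
qed simp

text \<open>Only the first vertex of \<open>t\<close> is attached directly onto \<open>s\<close>;
  \<open>stackable\<close> is the condition at that joint, and all others are internal to
  \<open>s\<close> or \<open>t\<close>.\<close>

lemma colored_lyndon_graft:
  assumes "increasing t" "\<forall>x \<in> set (labels t). valency s < x"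
  shows "colored_lyndon (graft s t) \<longleftrightarrow>
    colored_lyndon s \<and> lyndon t \<and> (\<forall>d c. first t = Some (d, c) \<longrightarrow> stackable s d c)"
  using assms
proof (induction t arbitrary: s)
  case (Vert b c A B C)
  let ?s = "Node c (graft s A) (graft (Leaf b) B)"
  have val: "valency (graft s A) = valency s" "valency (graft (Leaf b) B) = b"
    using Vert.prems by (simp_all add: valency_graft)
  have leaf: "stackable (Leaf b) d c'" for d c'
    by (simp add: stackable_def)
  \<comment> \<open>The right child of \<open>?s\<close> has valency \<open>b\<close>, below
    \<open>d\<close>, so the node above \<open>?s\<close> is not Lyndon and its color is
    constrained.\<close>
  have top: "stackable ?s d c' \<longleftrightarrow> c' < c" if "first C = Some (d, c')" for d c'
  proof -
    have "b < d"
      using Vert.prems first_in_labels[OF that] by auto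
    then show ?thesis by (simp add: stackable_def val)
  qed
  \<comment> \<open>For nonempty \<open>A\<close> the node of \<open>b\<close> is Lyndon, as
    \<open>b\<close> is below all labels of \<open>A\<close>; for empty \<open>A\<close> it sits
    directly on \<open>s\<close>.\<close>
  have mid: "stackable (graft s A) b c \<longleftrightarrow> A \<noteq> Tip \<or> stackable s b c"
  proof (cases "A = Tip")
    case False
    then have "b < valency (right (graft s A))"
      using valency_right_graft[of A s] Vert.prems by auto
    with False show ?thesis by (simp add: stackable_def)
  qed simp
  have IH: "colored_lyndon (graft ?s C) \<longleftrightarrow> colored_lyndon ?s \<and> lyndon C \<and>
              (\<forall>d c. first C = Some (d, c) \<longrightarrow> stackable ?s d c)"
    using Vert.prems val by (intro Vert.IH) auto
  have "colored_lyndon (graft s A) \<longleftrightarrow> colored_lyndon s \<and> lyndon A \<and>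
          (\<forall>d c. first A = Some (d, c) \<longrightarrow> stackable s d c)"
    using Vert.prems by (intro Vert.IH) auto
  moreover have "colored_lyndon (graft (Leaf b) B) \<longleftrightarrow> lyndon B"
    using Vert.prems Vert.IH(2)[of "Leaf b"] leaf by auto
  ultimately have "colored_lyndon ?s \<longleftrightarrow> colored_lyndon s \<and> lyndon A \<and> lyndon B \<and>
      (\<forall>d c'. first (Vert b c A B C) = Some (d, c') \<longrightarrow> stackable s d c')"
    using Vert.prems val mid by auto
  then show ?case
    unfolding graft.simps IH using top by (auto simp del: colored_lyndon_Node first.simps)
qed simp

section \<open>The inverse encoding\<close>

text \<open>\<open>snoc t b c B\<close> encodes the sequence of \<open>t\<close> extended by a last tree with smallest leaf \<open>b\<close>
  carrying the sequence \<open>B\<close>, attached by a node of color \<open>c\<close>.\<close>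

primrec snoc :: "ttree \<Rightarrow> nat \<Rightarrow> nat \<Rightarrow> ttree \<Rightarrow> ttree" where
  "snoc Tip b c B = Vert b c Tip B Tip"
| "snoc (Vert b' c' A' B' C') b c B =
     (if b' < b then Vert b' c' A' B' (snoc C' b c B) else Vert b c (Vert b' c' A' B' C') B Tip)"

primrec encode :: "ctree \<Rightarrow> ttree" where
  "encode (Leaf a) = Tip"
| "encode (Node c l r) = snoc (encode l) (valency r) c (encode r)"

lemma graft_snoc [simp]: "graft s (snoc t b c B) = Node c (graft s t) (graft (Leaf b) B)"
  by (induction t arbitrary: s) auto

lemma labels_snoc [simp]: "labels (snoc t b c B) = labels t @ b # labels B"
  by (induction t) auto

lemma increasing_snoc:
  assumes "increasing t" "increasing B" "\<forall>x \<in> set (labels B). b < x" "b \<notin> set (labels t)"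
  shows "increasing (snoc t b c B)"
  using assms
proof (induction t)
  case (Vert b' c' A' B' C')
  show ?case
  proof (cases "b' < b")
    case False
    then have "b < b'" using Vert.prems by simp
    with Vert.prems show ?thesis by (auto intro: less_trans)
  qed (use Vert in auto)
qed simp

lemma graft_encode: "normalized t \<Longrightarrow> graft (Leaf (valency t)) (encode t) = t"
  by (induction t) auto

lemma leaves_encode: "normalized t \<Longrightarrow> leaves t = valency t # labels (encode t)"
  by (metis append_Cons append_Nil graft_encode leaves.simps(1) leaves_graft)

lemma labels_encode_gt:
  assumes "normalized t" "distinct (leaves t)" "x \<in> set (labels (encode t))"
  shows "valency t < x"
proof -
  have "x \<in> set (leaves t)" "x \<noteq> valency t"
    using assms(2,3) unfolding leaves_encode[OF assms(1)] by auto
  with valency_le[of x t] show ?thesis by simp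
qed

lemma increasing_encode:
  assumes "normalized t" "distinct (leaves t)"
  shows "increasing (encode t)"
  using assms
proof (induction t)
  case (Node c l r)
  have "valency r \<notin> set (labels (encode l))"
    using Node.prems leaves_encode[of l] valency_in_leaves[of r] by auto
  with Node show ?case by (auto intro: increasing_snoc labels_encode_gt)
qed simp

text \<open>The operation on encodings that corresponds to \<open>graft\<close>, see \<open>encode_graft\<close> below.\<close>

primrec join :: "ttree \<Rightarrow> ttree \<Rightarrow> ttree" where
  "join u Tip = u"
| "join u (Vert b c A B C) = join (snoc (join u A) b c B) C"

text \<open>A root label below all labels still to come sends every later \<open>snoc\<close> down
  into the third subtree.\<close>

lemma join_Vert:
  "\<forall>x \<in> set (labels t). b < x \<Longrightarrow> join (Vert b c A B C) t = Vert b c A B (join C t)"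
  by (induction t arbitrary: C) auto

lemma snoc_min: "\<forall>x \<in> set (labels t). b < x \<Longrightarrow> snoc t b c B = Vert b c t B Tip"
  by (cases t) auto

text \<open>Rebuilding from nothing returns \<open>t\<close>: attaching the least label
  \<open>b\<close> takes all of \<open>A\<close> as its first subtree, and what follows collects in
  the third.\<close>

lemma join_Tip: "increasing t \<Longrightarrow> join Tip t = t"
  by (induction t) (auto simp: snoc_min join_Vert)

lemma encode_graft: "increasing t \<Longrightarrow> encode (graft s t) = join (encode s) t"
proof (induction t arbitrary: s)
  case (Vert b c A B C)
  then show ?case by (simp add: valency_graft join_Tip)
qed simp

section \<open>Restriction to trees on [n] and the resulting bijection\<close>

definition increasing_on :: "nat \<Rightarrow> ttree set" where
  "increasing_on n =
     {t. increasing t \<and> distinct (labels t) \<and> set (labels t) = {2..n} \<and> (\<forall>c \<in> set (colors t). 1 \<le> c)}"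

lemma bij_betw_graft:
  assumes "1 \<le> n"
  shows "bij_betw (graft (Leaf 1)) (increasing_on n) {t \<in> labeled_trees n. normalized t}"
proof (rule bij_betw_byWitness[where f' = encode])
  \<comment> \<open>The leaf 1 is the bottom of the left spine and is supplied to
    \<open>graft\<close> separately, so encodings carry the labels from 2 on.\<close>
  have ins: "insert (Suc 0) {2..n} = {1..n}"
    using assms by auto
  show "\<forall>t \<in> increasing_on n. encode (graft (Leaf 1) t) = t"
    by (auto simp: increasing_on_def encode_graft join_Tip)
  have val: "valency t = 1" if "t \<in> labeled_trees n" for t
    using that assms by (auto simp: labeled_trees_def valency_def intro: Min_eqI)
  show *: "\<forall>t \<in> {t \<in> labeled_trees n. normalized t}. graft (Leaf 1) (encode t) = t"
    using graft_encode val by fastforce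
  show "graft (Leaf 1) ` increasing_on n \<subseteq> {t \<in> labeled_trees n. normalized t}"
    using ins by (auto simp: increasing_on_def labeled_trees_def intro!: normalized_graft)
  show "encode ` {t \<in> labeled_trees n. normalized t} \<subseteq> increasing_on n"
  proof clarify
    fix t assume t: "t \<in> labeled_trees n" "normalized t"
    have lv: "leaves t = 1 # labels (encode t)"
      using leaves_encode[OF t(2)] val[OF t(1)] by simp
    have "node_colors t = node_colors (graft (Leaf 1) (encode t))"
      using * t by simp
    then have "set (node_colors t) = set (colors (encode t))"
      by simp
    moreover have "set (labels (encode t)) = {2..n}"
    proof -
      have "distinct (leaves t)" "set (leaves t) = {1..n}"
        using t(1) by (simp_all add: labeled_trees_def)
      then have "1 \<notin> set (labels (encode t))" "insert 1 (set (labels (encode t))) = {1..n}"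
        unfolding lv by simp_all
      then have "set (labels (encode t)) = {1..n} - {1}"
        by (metis Diff_insert_absorb)
      also have "\<dots> = {2..n}"
        by auto
      finally show ?thesis .
    qed
    ultimately show "encode t \<in> increasing_on n"
      using t lv by (auto simp: increasing_on_def labeled_trees_def increasing_encode)
  qed
qed

lemma bij_betw_Collect:
  assumes "bij_betw f A B" "\<And>x. x \<in> A \<Longrightarrow> Q (f x) \<longleftrightarrow> P x"
  shows "bij_betw f {x \<in> A. P x} {y \<in> B. Q y}"
  using assms unfolding bij_betw_def by (auto intro: inj_on_subset)

lemma bij_betw_rot3: "bij_betw rot3 (increasing_on n) (increasing_on n)"
  by (rule bij_betw_byWitness[where f' = "rot3 \<circ> rot3"]) (auto simp: increasing_on_def)

theorem theorem5p4:
  fixes n :: nat and \<mu> :: "nat \<Rightarrow> nat"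
  assumes "n \<ge> 1" and "\<mu> \<in> WComp (n - 1)"
  shows "\<exists>f. bij_betw f (Lyn n \<mu>) (Comb n \<mu>)"
proof -
  let ?T = "{t \<in> labeled_trees n. normalized t}"
  define content where "content = (\<lambda>cs. \<forall>j \<ge> 1. count_list cs j = \<mu> j)"
  have Lyn: "Lyn n \<mu> = {t \<in> ?T. colored_lyndon t \<and> content (node_colors t)}"
    by (auto simp: Lyn_def content_def colored_lyndon_def)
  have Comb: "Comb n \<mu> = {t \<in> ?T. colored_comb t \<and> content (node_colors t)}"
    by (auto simp: Comb_def content_def colored_comb_def)
  have 1: "bij_betw (graft (Leaf 1)) {t \<in> increasing_on n. lyndon t \<and> content (colors t)} (Lyn n \<mu>)"
    unfolding Lyn
    by (rule bij_betw_Collect[OF bij_betw_graft[OF assms(1)]])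
      (auto simp: increasing_on_def colored_lyndon_graft content_def stackable_def)
  have 2: "bij_betw (graft (Leaf 1)) {t \<in> increasing_on n. comb t \<and> content (colors t)} (Comb n \<mu>)"
    unfolding Comb
    by (rule bij_betw_Collect[OF bij_betw_graft[OF assms(1)]])
      (auto simp: increasing_on_def colored_comb_graft content_def)
  have 3: "bij_betw rot3 {t \<in> increasing_on n. lyndon t \<and> content (colors t)}
      {t \<in> increasing_on n. comb t \<and> content (colors t)}"
    by (rule bij_betw_Collect[OF bij_betw_rot3]) (simp add: content_def)
  show ?thesis
    \<comment> \<open>Encode a Lyndon tree, rotate, and graft the result back as a comb.\<close>
    using bij_betw_trans[OF bij_betw_inv_into[OF 1] bij_betw_trans[OF 3 2]] by blast
qed

end
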